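(* Let $G$ be a finite connected graph without loops or multiple edges, with $n=|V(G)|$ and $m=|E(G)|$, and let ${\bf W}$ be a quaternionic weighted matrix of $G$. Then, for a quaternionic variable $t$ (with $t^2\neq 1$ in case $m<n$, so that the right-hand side is defined), the reciprocal of the quaternionic second weighted zeta function of $G$ is given by $$ {\bf Z}^{\mathbb{H}}_1 (G,w,t )^{-1} =|1- t^2 |^{2m-2n}\, \operatorname{Sdet}\bigl({\bf I}_n - {\bf W}t+( {\bf D}_w - {\bf I}_n ) t^2 \bigr), $$ where ${\bf D}_w=({\bf D}^{(w)}_{uv})_{u,v\in V(G)}$ is the diagonal matrix with ${\bf D}^{(w)}_{uu} = \sum_{e:\,o(e)=u}w(e)$, the sum being over arcs $e\in D(G)$.
   Context: $\mathbb{H}$ is the skew field of quaternions with $\mathbb{R}$-basis $1,i,j,k$; $|x|=\sqrt{xx^*}$ is the quaternion norm. $\operatorname{Mat}(p\times q,\mathbb{H})$ is the set of $p\times q$ quaternionic matrices, and $\operatorname{Mat}(p,\mathbb{H})=\operatorname{Mat}(p\times p,\mathbb{H})$. For ${\bf M}\in\operatorname{Mat}(p\times q,\mathbb{H})$ and $t\in\mathbb{H}$, $t{\bf M}$ (resp. ${\bf M}t$) is obtained by multiplying every entry by $t$ on the left (resp. right). Study determinant: every ${\bf M}\in\operatorname{Mat}(p,\mathbb{H})$ is written uniquely as ${\bf M}={\bf M}^S+j{\bf M}^P$ with ${\bf M}^S,{\bf M}^P$ complex matrices. Put $\psi({\bf M})=\begin{bmatrix}{\bf M}^S&-\overline{{\bf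 M}^P}\\ {\bf M}^P&\overline{{\bf M}^S}\end{bmatrix}$ (a $2p\times 2p$ complex matrix) and $\operatorname{Sdet}({\bf M})=\det(\psi({\bf M}))$, with $\det$ the ordinary determinant. Graph notation: $V(G)$ is the vertex set, $E(G)$ the set of undirected edges, and $D(G)=\{(u,v),(v,u)\mid uv\in E(G)\}$ the set of arcs, so $|D(G)|=2m$. For $e=(u,v)\in D(G)$, $o(e)=u$, $t(e)=v$, $e^{-1}=(v,u)$. A quaternionic weighted matrix of $G$ is a matrix ${\bf W}=({\bf W}_{uv})_{u,v\in V(G)}\in\operatorname{Mat}(n,\mathbb{H})$ with ${\bf W}_{uv}=0$ whenever $(u,v)\notin D(G)$; put $w(u,v)={\bf W}_{uv}$ and $w(e)=w(u,v)$ for $e=(u,v)\in D(G)$. Let ${\bf B}_w=({\bf B}^{(w)}_{ef})_{e,f\in D(G)}$ with ${\bf B}^{(w)}_{ef}=w(f)$ if $t(e)=o(f)$ and $0$ otherwise, and ${\bf J}_0=({\bf J}_{ef})_{e,f\in D(G)}$ with ${\bf J}_{ef}=1$ if $f=e^{-1}$ and $0$ otherwise. The quaternionic second weighted zeta function of $G$ is ${\bf Z}^{\mathbb{H}}_1 (G,w,t)= \operatorname{Sdet} ( {\bf I}_{2m} -t ( {\bf B}_w - {\bf J}_0 ) )^{-1}$, where $t$ is a quaternionic variable; so its reciprocal is ${\bf Z}^{\mathbb{H}}_1(G,w,t)^{-1}=\operatorname{Sdet} ( {\bf I}_{2m} -t ( {\bf B}_w - {\bf J}_0 ) )$. The convention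 $0^0=1$ is used. *)

theory Defs
  imports Complex_Main "Jordan_Normal_Form.Determinant" "Graph_Theory.Graph_Theory"
begin

section \<open>Quaternions\<close>

text \<open>\<open>Quat a b c d\<close> is \<open>a + b i + c j + d k\<close>, with \<open>i j = k\<close>, \<open>j k = i\<close>, \<open>k i = j\<close>.\<close>

datatype quat = Quat (qRe: real) (qI: real) (qJ: real) (qK: real)

instantiation quat :: division_ring
begin

definition "0 = Quat 0 0 0 0"
definition "1 = Quat 1 0 0 0"
definition "x + y = Quat (qRe x + qRe y) (qI x + qI y) (qJ x + qJ y) (qK x + qK y)"
definition "- x = Quat (- qRe x) (- qI x) (- qJ x) (- qK x)"
definition "x - y = Quat (qRe x - qRe y) (qI x - qI y) (qJ x - qJ y) (qK x - qK y)"
definition "x * y = Quat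
  (qRe x * qRe y - qI x * qI y - qJ x * qJ y - qK x * qK y)
  (qRe x * qI y + qI x * qRe y + qJ x * qK y - qK x * qJ y)
  (qRe x * qJ y - qI x * qK y + qJ x * qRe y + qK x * qI y)
  (qRe x * qK y + qI x * qJ y - qJ x * qI y + qK x * qRe y)"
definition "inverse x =
  (let N = (qRe x)\<^sup>2 + (qI x)\<^sup>2 + (qJ x)\<^sup>2 + (qK x)\<^sup>2
   in Quat (qRe x / N) (- qI x / N) (- qJ x / N) (- qK x / N))"
definition "x div y = x * inverse y" for x y :: quat

lemmas quat_ops = zero_quat_def one_quat_def plus_quat_def uminus_quat_def minus_quat_def
  times_quat_def

lemma quat_norm_sum_pos:
  assumes "x \<noteq> (0 :: quat)"
  shows "(qRe x)\<^sup>2 + (qI x)\<^sup>2 + (qJ x)\<^sup>2 + (qK x)\<^sup>2 > 0"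
proof -
  have "qRe x \<noteq> 0 \<or> qI x \<noteq> 0 \<or> qJ x \<noteq> 0 \<or> qK x \<noteq> 0"
    using assms by (cases x) (auto simp: zero_quat_def)
  then show ?thesis
    by (smt (verit) zero_le_power2 zero_less_power2)
qed

instance
proof
  fix x :: quat
  assume "x \<noteq> 0"
  note N = quat_norm_sum_pos[OF this]
  show "inverse x * x = 1"
    using N by (simp add: inverse_quat_def quat_ops Let_def power2_eq_square
        add_divide_distrib[symmetric] diff_divide_distrib[symmetric] mult.commute)
  show "x * inverse x = 1"
    using N by (simp add: inverse_quat_def quat_ops Let_def power2_eq_square
        add_divide_distrib[symmetric] diff_divide_distrib[symmetric] mult.commute)
qed (auto simp: quat_ops inverse_quat_def divide_quat_def algebra_simps intro!: quat.expand)

end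

definition quat_i :: quat where "quat_i = Quat 0 1 0 0"
definition quat_j :: quat where "quat_j = Quat 0 0 1 0"
definition quat_k :: quat where "quat_k = Quat 0 0 0 1"

lemma quat_units:
  "quat_i * quat_i = - 1" "quat_j * quat_j = - 1" "quat_k * quat_k = - 1"
  "quat_i * quat_j = quat_k" "quat_j * quat_k = quat_i" "quat_k * quat_i = quat_j"
  by (simp_all add: quat_i_def quat_j_def quat_k_def quat_ops)

definition qcnj :: "quat \<Rightarrow> quat" where
  "qcnj x = Quat (qRe x) (- qI x) (- qJ x) (- qK x)"

text \<open>The norm \<open>|x|\<close> is the square root of \<open>x x\<^sup>*\<close>, which is a real quaternion.\<close>

definition qnorm :: "quat \<Rightarrow> real" where
  "qnorm x = sqrt (qRe (x * qcnj x))"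

lemma mult_qcnj: "x * qcnj x = Quat ((qRe x)\<^sup>2 + (qI x)\<^sup>2 + (qJ x)\<^sup>2 + (qK x)\<^sup>2) 0 0 0"
  by (simp add: qcnj_def quat_ops power2_eq_square)

definition quat_of_complex :: "complex \<Rightarrow> quat" where
  "quat_of_complex z = Quat (Re z) (Im z) 0 0"

section \<open>Study determinant\<close>

text \<open>
  The two complex parts of a quaternion \<open>x = S + j P\<close>.  As \<open>j\<close> stands on the left and
  \<open>j i = - k\<close>, the imaginary part of \<open>P\<close> carries a minus sign.
\<close>

definition simplex_part :: "quat \<Rightarrow> complex" where
  "simplex_part x = Complex (qRe x) (qI x)"

definition perplex_part :: "quat \<Rightarrow> complex" where
  "perplex_part x = Complex (qJ x) (- qK x)"

lemma simplex_perplex_unique: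
  "x = quat_of_complex s + quat_j * quat_of_complex p
    \<longleftrightarrow> s = simplex_part x \<and> p = perplex_part x"
  by (cases x) (auto simp: quat_of_complex_def quat_j_def simplex_part_def perplex_part_def
      quat_ops complex_eq_iff)

definition psi :: "quat mat \<Rightarrow> complex mat" where
  "psi M =
    (let S = map_mat simplex_part M; P = map_mat perplex_part M
     in four_block_mat S (- map_mat cnj P) P (map_mat cnj S))"

definition Sdet :: "quat mat \<Rightarrow> complex" where
  "Sdet M = det (psi M)"

text \<open>\<open>t \<cdot>\<^sub>m M\<close> multiplies the entries by \<open>t\<close> on the left; this is its right-hand counterpart.\<close>

definition smult_mat_right :: "quat mat \<Rightarrow> quat \<Rightarrow> quat mat" (infixl \<open>\<cdot>\<^sub>r\<close> 70) where
  "M \<cdot>\<^sub>r t = map_mat (\<lambda>x. x * t) M"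

text \<open>
  A matrix whose rows and columns are indexed by a finite set is given by its entries
  together with a repetition-free list enumerating the index set.
\<close>

definition mat_on :: "'b list \<Rightarrow> ('b \<Rightarrow> 'b \<Rightarrow> 'c) \<Rightarrow> 'c mat" where
  "mat_on xs F = mat (length xs) (length xs) (\<lambda>(i, j). F (xs ! i) (xs ! j))"

section \<open>Graphs and the second weighted zeta function\<close>

text \<open>
  A finite graph without loops or multiple edges is a \<^locale>\<open>pair_graph\<close>, that is, a finite
  loopless digraph with a symmetric arc set \<^term>\<open>parcs G\<close>; this arc set is \<open>D(G)\<close>.
\<close>

definition edges :: "'a pair_pre_digraph \<Rightarrow> 'a set set" where
  "edges G = {{u, v} | u v. (u, v) \<in> parcs G}"

lemma (in pair_graph) parcs_conv_edges: "parcs G = {(u, v). {u, v} \<in> edges G}"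
proof -
  have "(v, u) \<in> parcs G" if "(u, v) \<in> parcs G" for u v
    using that pair_sym_arcs by (auto simp: symmetric_def dest: symD)
  then show ?thesis
    by (auto simp: edges_def doubleton_eq_iff)
qed

lemma (in pair_graph) card_parcs: "card (parcs G) = 2 * card (edges G)"
proof -
  define f where "f = (\<lambda>e :: 'a \<times> 'a. {fst e, snd e})"
  have sym: "(v, u) \<in> parcs G" if "(u, v) \<in> parcs G" for u v
    using that pair_sym_arcs by (auto simp: symmetric_def dest: symD)
  have img: "edges G = f ` parcs G"
    by (force simp: edges_def f_def)
  have fib: "card {e \<in> parcs G. f e = E} = 2" if E: "E \<in> edges G" for E
  proof -
    obtain u v where uv: "(u, v) \<in> parcs G" "E = {u, v}"
      using E by (auto simp: edges_def)
    then have "{e \<in> parcs G. f e = E} = {(u, v), (v, u)}"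
      using sym by (auto simp: f_def doubleton_eq_iff)
    moreover have "u \<noteq> v"
      using pair_no_loops[OF uv(1)] by simp
    ultimately show ?thesis by simp
  qed
  have "card (parcs G) = (\<Sum>E\<in>edges G. card {e \<in> parcs G. f e = E})"
    using sum.image_gen[OF pair_finite_arcs, of "\<lambda>_. 1 :: nat" f] by (simp add: img)
  then show ?thesis
    using fib by simp
qed

definition quat_weighted_matrix ::
    "'a pair_pre_digraph \<Rightarrow> ('a \<Rightarrow> 'a \<Rightarrow> quat) \<Rightarrow> bool" where
  "quat_weighted_matrix G W \<longleftrightarrow>
    (\<forall>u \<in> pverts G. \<forall>v \<in> pverts G. (u, v) \<notin> parcs G \<longrightarrow> W u v = 0)"

definition arc_weight :: "('a \<Rightarrow> 'a \<Rightarrow> quat) \<Rightarrow> 'a \<times> 'a \<Rightarrow> quat" where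
  "arc_weight W e = W (fst e) (snd e)"

definition B_entry :: "('a \<Rightarrow> 'a \<Rightarrow> quat) \<Rightarrow> 'a \<times> 'a \<Rightarrow> 'a \<times> 'a \<Rightarrow> quat" where
  "B_entry W e f = (if snd e = fst f then arc_weight W f else 0)"

definition J_entry :: "'a \<times> 'a \<Rightarrow> 'a \<times> 'a \<Rightarrow> quat" where
  "J_entry e f = (if f = prod.swap e then 1 else 0)"

definition D_entry ::
    "'a pair_pre_digraph \<Rightarrow> ('a \<Rightarrow> 'a \<Rightarrow> quat) \<Rightarrow> 'a \<Rightarrow> 'a \<Rightarrow> quat" where
  "D_entry G W u v =
    (if u = v then \<Sum>e \<in> {e \<in> parcs G. fst e = u}. arc_weight W e else 0)"

text \<open>The list \<open>es\<close> enumerates the arcs of \<open>G\<close>.\<close>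

definition second_weighted_zeta ::
    "'a pair_pre_digraph \<Rightarrow> ('a \<times> 'a) list \<Rightarrow> ('a \<Rightarrow> 'a \<Rightarrow> quat) \<Rightarrow> quat \<Rightarrow> complex" where
  "second_weighted_zeta G es W t =
    inverse (Sdet (1\<^sub>m (2 * card (edges G))
      - t \<cdot>\<^sub>m (mat_on es (B_entry W) - mat_on es J_entry)))"

end

theory Submission
  imports Defs
begin

text \<open>
  The identity is Bass's determinant formula, carried over to quaternions.  For the arcs \<open>e, f\<close>
  and the vertices \<open>u, v\<close> put \<open>K\<^bsub>ev\<^esub> = t\<close> if \<open>e\<close> ends in \<open>v\<close> and \<open>L\<^bsub>uf\<^esub> = w(f)\<close> if \<open>f\<close> starts in \<open>u\<close>
  (all other entries vanish), and let \<open>J\<close> be the matrix of arc reversal.  Then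
  \<open>I - t (B - J) = A - K L\<close> with \<open>A = I + t J\<close>.  Since \<open>J\<close> is real and \<open>J\<^sup>2 = I\<close>, the matrix \<open>A\<close>
  commutes with \<open>I - t J\<close> and their product is the scalar matrix of \<open>1 - t\<^sup>2\<close>.  Hence
  \<open>X = (I - t J) K\<close> satisfies \<open>A X = K Y\<close> with \<open>Y = (1 - t\<^sup>2) I\<^sub>n\<close>, and \<open>Y - L X\<close> turns out to be
  exactly the vertex matrix \<open>I - W t + (D - I) t\<^sup>2\<close>.

  An equation \<open>A X = K Y\<close> always implies
  \<open>Sdet (A - K L) Sdet Y = Sdet A Sdet (Y - L X)\<close>: this is a block determinant computation which
  inverts nothing (\<open>det_schur_intertwining\<close>), and it passes to quaternions because \<open>psi\<close> respects
  differences and products of rectangular matrices (\<open>psi_mult\<close>).  There remain two explicit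
  Study determinants.  That of \<open>Y\<close> is \<open>|1 - t\<^sup>2|\<^sup>2\<^sup>n\<close>, and that of \<open>A\<close> is \<open>|1 - t\<^sup>2|\<^sup>2\<^sup>m\<close>
  (\<open>Sdet_one_add_smult_reversal\<close>).  Together this is \<open>Sdet_bass_identity\<close>, the theorem multiplied
  by \<open>|1 - t\<^sup>2|\<^sup>2\<^sup>n\<close>, valid for every quaternion \<open>t\<close>.

  If \<open>t\<^sup>2 \<noteq> 1\<close> the factor can be cancelled.  If \<open>t\<^sup>2 = 1\<close>, then \<open>t = 1\<close> or \<open>t = -1\<close>, because the
  quaternions form a skew field, and \<open>m \<ge> n\<close>; both sides are continuous along the real axis
  and agree at all other real points, so they agree at \<open>t\<close> as well.
\<close>

section \<open>Matrices indexed by two lists\<close>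

text \<open>
  The incidence matrices between arcs and vertices are rectangular; row and column labels are
  enumerated separately, and matrix products become sums over the set of middle labels.
\<close>

definition mat_between :: "'b list \<Rightarrow> 'c list \<Rightarrow> ('b \<Rightarrow> 'c \<Rightarrow> 'd) \<Rightarrow> 'd mat" where
  "mat_between xs ys F = mat (length xs) (length ys) (\<lambda>(i, j). F (xs ! i) (ys ! j))"

lemma mat_between_carrier [simp]:
  "mat_between xs ys F \<in> carrier_mat (length xs) (length ys)"
  "dim_row (mat_between xs ys F) = length xs" "dim_col (mat_between xs ys F) = length ys"
  by (simp_all add: mat_between_def)

lemma index_mat_between [simp]:
  "i < length xs \<Longrightarrow> j < length ys \<Longrightarrow> mat_between xs ys F $$ (i, j) = F (xs ! i) (ys ! j)"
  by (simp add: mat_between_def)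

lemma mat_on_eq_mat_between: "mat_on xs F = mat_between xs xs F"
  by (simp add: mat_on_def mat_between_def)

lemma mat_between_cong:
  assumes "\<And>x y. x \<in> set xs \<Longrightarrow> y \<in> set ys \<Longrightarrow> F x y = H x y"
  shows "mat_between xs ys F = mat_between xs ys H"
  by (rule eq_matI) (auto simp: assms)

lemma mat_between_mult:
  fixes F :: "'b \<Rightarrow> 'c \<Rightarrow> 'r :: semiring_0"
  assumes "distinct ys"
  shows "mat_between xs ys F * mat_between ys zs H
    = mat_between xs zs (\<lambda>x z. \<Sum>y\<in>set ys. F x y * H y z)"
proof (rule eq_matI)
  fix i j assume ij: "i < dim_row (mat_between xs zs (\<lambda>x z. \<Sum>y\<in>set ys. F x y * H y z))"
    "j < dim_col (mat_between xs zs (\<lambda>x z. \<Sum>y\<in>set ys. F x y * H y z))"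
  have "bij_betw ((!) ys) {0..<length ys} (set ys)"
    using bij_betw_nth[OF assms] by (simp add: atLeast0LessThan)
  from sum.reindex_bij_betw[OF this, of "\<lambda>y. F (xs ! i) y * H y (zs ! j)"]
  show "(mat_between xs ys F * mat_between ys zs H) $$ (i, j)
    = mat_between xs zs (\<lambda>x z. \<Sum>y\<in>set ys. F x y * H y z) $$ (i, j)"
    using ij by (simp add: scalar_prod_def)
qed auto

lemma one_mat_eq_mat_between:
  assumes "distinct xs" "n = length xs"
  shows "1\<^sub>m n = mat_between xs xs (\<lambda>x y. if x = y then 1 else 0)"
  by (rule eq_matI) (auto simp: assms nth_eq_iff_index_eq)

section \<open>Multiplicativity of the Study determinant\<close>

lemma simplex_part_simps [simp]:
  "simplex_part 0 = 0" "simplex_part 1 = 1"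
  "simplex_part (x + y) = simplex_part x + simplex_part y"
  "simplex_part (x - y) = simplex_part x - simplex_part y"
  "simplex_part (x * y) = simplex_part x * simplex_part y - cnj (perplex_part x) * perplex_part y"
  by (simp_all add: simplex_part_def perplex_part_def quat_ops complex_eq_iff)

lemma perplex_part_simps [simp]:
  "perplex_part 0 = 0" "perplex_part 1 = 0"
  "perplex_part (x + y) = perplex_part x + perplex_part y"
  "perplex_part (x - y) = perplex_part x - perplex_part y"
  "perplex_part (x * y) = perplex_part x * simplex_part y + cnj (simplex_part x) * perplex_part y"
  by (simp_all add: simplex_part_def perplex_part_def quat_ops complex_eq_iff)

lemma simplex_part_sum: "simplex_part (sum f A) = (\<Sum>a\<in>A. simplex_part (f a))"
  by (induction A rule: infinite_finite_induct) auto

lemma perplex_part_sum: "perplex_part (sum f A) = (\<Sum>a\<in>A. perplex_part (f a))"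
  by (induction A rule: infinite_finite_induct) auto

lemma psi_carrier [simp]: "M \<in> carrier_mat p q \<Longrightarrow> psi M \<in> carrier_mat (p + p) (q + q)"
  by (auto simp: psi_def Let_def)

lemma psi_minus:
  assumes "A \<in> carrier_mat p q" "B \<in> carrier_mat p q"
  shows "psi (A - B) = psi A - psi B"
  using assms by (intro eq_matI) (auto simp: psi_def Let_def)

text \<open>
  For \<open>x = s + j p\<close> and \<open>y = s' + j p'\<close> the rule \<open>z j = j cnj z\<close> for complex \<open>z\<close> gives
  \<open>x y = (s s' - cnj p p') + j (p s' + cnj s p')\<close>, which are the two
  entries in the first block column of the product; the second block column is obtained from it
  by conjugation.
\<close>

lemma psi_mult:
  assumes A: "A \<in> carrier_mat p q" and B: "B \<in> carrier_mat q r"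
  shows "psi (A * B) = psi A * psi B"
proof -
  let ?S = "map_mat simplex_part" and ?P = "map_mat perplex_part" and ?c = "map_mat cnj"
  have "psi A * psi B = four_block_mat
     (?S A * ?S B + - ?c (?P A) * ?P B) (?S A * - ?c (?P B) + - ?c (?P A) * ?c (?S B))
     (?P A * ?S B + ?c (?S A) * ?P B) (?P A * - ?c (?P B) + ?c (?S A) * ?c (?S B))"
    unfolding psi_def Let_def using A B
    by (subst mult_four_block_mat[where ?nr1.0 = p and ?nr2.0 = p and ?n1.0 = q and ?n2.0 = q
          and ?nc1.0 = r and ?nc2.0 = r]) auto
  also have "?S A * ?S B + - ?c (?P A) * ?P B = ?S (A * B)"
    using A B by (intro eq_matI)
      (auto simp: scalar_prod_def simplex_part_sum sum_subtractf sum_negf)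
  also have "?S A * - ?c (?P B) + - ?c (?P A) * ?c (?S B) = - ?c (?P (A * B))"
    using A B by (intro eq_matI)
      (auto simp: scalar_prod_def perplex_part_sum sum.distrib sum_negf algebra_simps)
  also have "?P A * ?S B + ?c (?S A) * ?P B = ?P (A * B)"
    using A B by (intro eq_matI)
      (auto simp: scalar_prod_def perplex_part_sum sum.distrib)
  also have "?P A * - ?c (?P B) + ?c (?S A) * ?c (?S B) = ?c (?S (A * B))"
    using A B by (intro eq_matI)
      (auto simp: scalar_prod_def simplex_part_sum sum_subtractf sum_negf)
  finally show ?thesis by (simp add: psi_def Let_def)
qed

section \<open>A block determinant identity\<close>

lemma minus_add_cancel_mat:
  fixes A :: "'r :: ab_group_add mat"
  assumes "A \<in> carrier_mat p q" "B \<in> carrier_mat p q"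
  shows "A - B + B = A"
  using assms by (intro eq_matI) auto

text \<open>
  When \<open>A\<close> and \<open>Y\<close> are invertible this is Sylvester's identity \<open>det (I - P Q) = det (I - Q P)\<close>
  with \<open>X = A\<^sup>-\<^sup>1 K Y\<close>.  The form with an intertwining \<open>X\<close> is division-free.  It follows from
  the factorisation of the block matrix with rows \<open>A, 0\<close> and \<open>L, Y - L X\<close> as the product of
  the block triangular matrices with rows \<open>A - K L, K\<close> and \<open>0, I\<close>; \<open>I, 0\<close> and \<open>L, I\<close>;
  \<open>I, -X\<close> and \<open>0, Y\<close>.
\<close>

lemma det_schur_intertwining:
  fixes A :: "'r :: idom mat"
  assumes A: "A \<in> carrier_mat N N" and K: "K \<in> carrier_mat N n" and L: "L \<in> carrier_mat n N"
    and X: "X \<in> carrier_mat N n" and Y: "Y \<in> carrier_mat n n"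
    and AX: "A * X = K * Y"
  shows "det (A - K * L) * det Y = det A * det (Y - L * X)"
proof -
  let ?M1 = "four_block_mat (A - K * L) K (0\<^sub>m n N) (1\<^sub>m n)"
  let ?M2 = "four_block_mat (1\<^sub>m N) (0\<^sub>m N n) L (1\<^sub>m n)"
  let ?M3 = "four_block_mat (1\<^sub>m N) (- X) (0\<^sub>m n N) Y"
  let ?R = "four_block_mat A (0\<^sub>m N n) L (Y - L * X)"
  have KL: "K * L \<in> carrier_mat N N" "A - K * L \<in> carrier_mat N N"
    and LX: "L * X \<in> carrier_mat n n" "Y - L * X \<in> carrier_mat n n"
    and KY: "K * Y \<in> carrier_mat N n" and mX: "- X \<in> carrier_mat N n"
    using A K L X Y by auto
  have "?M1 * ?M2 = four_block_mat ((A - K * L) * 1\<^sub>m N + K * L) ((A - K * L) * 0\<^sub>m N n + K * 1\<^sub>m n)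
      (0\<^sub>m n N * 1\<^sub>m N + 1\<^sub>m n * L) (0\<^sub>m n N * 0\<^sub>m N n + 1\<^sub>m n * 1\<^sub>m n)"
    by (rule mult_four_block_mat[OF KL(2) K zero_carrier_mat one_carrier_mat
          one_carrier_mat zero_carrier_mat L one_carrier_mat])
  also have "(A - K * L) * 1\<^sub>m N + K * L = A"
    unfolding right_mult_one_mat[OF KL(2)] by (rule minus_add_cancel_mat[OF A KL(1)])
  also have "(A - K * L) * 0\<^sub>m N n + K * 1\<^sub>m n = K"
    unfolding right_mult_zero_mat[OF KL(2)] right_mult_one_mat[OF K] using K by simp
  also have "0\<^sub>m n N * 1\<^sub>m N + 1\<^sub>m n * L = L"
    using L by simp
  also have "0\<^sub>m n N * 0\<^sub>m N n + 1\<^sub>m n * 1\<^sub>m n = (1\<^sub>m n :: 'r mat)"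
    by simp
  finally have 1: "?M1 * ?M2 = four_block_mat A K L (1\<^sub>m n)" .
  have "four_block_mat A K L (1\<^sub>m n) * ?M3 = four_block_mat (A * 1\<^sub>m N + K * 0\<^sub>m n N)
      (A * (- X) + K * Y) (L * 1\<^sub>m N + 1\<^sub>m n * 0\<^sub>m n N) (L * (- X) + 1\<^sub>m n * Y)"
    by (rule mult_four_block_mat[OF A K L one_carrier_mat one_carrier_mat mX zero_carrier_mat Y])
  also have "A * 1\<^sub>m N + K * 0\<^sub>m n N = A"
    using A K by simp
  also have "A * (- X) + K * Y = 0\<^sub>m N n"
    using A X uminus_l_inv_mat[OF KY] by (subst uminus_mult_right_mat) (auto simp: AX)
  also have "L * 1\<^sub>m N + 1\<^sub>m n * 0\<^sub>m n N = L"
    using L by simp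
  also have "L * (- X) + 1\<^sub>m n * Y = Y - L * X"
    using L X Y LX by (subst uminus_mult_right_mat) (auto intro!: eq_matI)
  finally have 2: "four_block_mat A K L (1\<^sub>m n) * ?M3 = ?R" .
  have c: "?M1 \<in> carrier_mat (N + n) (N + n)" "?M2 \<in> carrier_mat (N + n) (N + n)"
    "?M3 \<in> carrier_mat (N + n) (N + n)"
    using A K L X Y by auto
  have "det A * det (Y - L * X) = det ?R"
    by (rule det_four_block_mat_upper_right_zero[OF A refl L LX(2), symmetric])
  also have "\<dots> = det (?M1 * ?M2 * ?M3)" by (simp only: 1 2)
  also have "\<dots> = det ?M1 * det ?M2 * det ?M3"
    unfolding det_mult[OF mult_carrier_mat[OF c(1,2)] c(3)] det_mult[OF c(1,2)] ..
  also have "det ?M1 = det (A - K * L) * det (1\<^sub>m n)"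
    by (rule det_four_block_mat_lower_left_zero[OF KL(2) K refl one_carrier_mat])
  also have "det ?M2 = det (1\<^sub>m N) * det (1\<^sub>m n)"
    by (rule det_four_block_mat_upper_right_zero[OF one_carrier_mat refl L one_carrier_mat])
  also have "det ?M3 = det (1\<^sub>m N) * det Y"
    by (rule det_four_block_mat_lower_left_zero[OF one_carrier_mat mX refl Y])
  finally show ?thesis by simp
qed

text \<open>
  The noncommutative version: \<open>psi\<close> maps the intertwining relation and both Schur complements
  to complex matrices of twice the size.
\<close>

lemma Sdet_schur_intertwining:
  assumes A: "A \<in> carrier_mat N N" and K: "K \<in> carrier_mat N n" and L: "L \<in> carrier_mat n N"
    and X: "X \<in> carrier_mat N n" and Y: "Y \<in> carrier_mat n n"
    and AX: "A * X = K * Y"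
  shows "Sdet (A - K * L) * Sdet Y = Sdet A * Sdet (Y - L * X)"
proof -
  have KL: "K * L \<in> carrier_mat N N" and LX: "L * X \<in> carrier_mat n n"
    using K L X by auto
  have "psi A * psi X = psi K * psi Y"
    using psi_mult[OF A X] psi_mult[OF K Y] AX by simp
  from det_schur_intertwining[OF psi_carrier[OF A] psi_carrier[OF K] psi_carrier[OF L]
      psi_carrier[OF X] psi_carrier[OF Y] this]
  show ?thesis
    unfolding Sdet_def psi_minus[OF A KL] psi_minus[OF Y LX] psi_mult[OF K L] psi_mult[OF L X] .
qed

section \<open>Scalar matrices and arc reversal\<close>

lemma qnorm_power2: "(qnorm x)\<^sup>2 = (qRe x)\<^sup>2 + (qI x)\<^sup>2 + (qJ x)\<^sup>2 + (qK x)\<^sup>2"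
  by (simp add: qnorm_def mult_qcnj)

lemma qnorm_nonneg: "qnorm x \<ge> 0"
  by (simp add: qnorm_def mult_qcnj)

lemma qnorm_mult: "qnorm (x * y) = qnorm x * qnorm y"
proof -
  have "(qnorm (x * y))\<^sup>2 = (qnorm x * qnorm y)\<^sup>2"
    unfolding power_mult_distrib qnorm_power2 by (simp add: times_quat_def power2_eq_square algebra_simps)
  then show ?thesis
    using qnorm_nonneg by (simp add: power2_eq_iff_nonneg)
qed

lemma qnorm_eq_0_iff: "qnorm x = 0 \<longleftrightarrow> x = 0"
  using quat_norm_sum_pos[of x] qnorm_power2[of x]
  by (cases "x = 0") (auto simp: zero_quat_def)

lemma simplex_perplex_qnorm:
  "simplex_part x * cnj (simplex_part x) + cnj (perplex_part x) * perplex_part x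
    = (complex_of_real (qnorm x))\<^sup>2"
  unfolding of_real_power[symmetric] qnorm_power2
  by (simp add: simplex_part_def perplex_part_def complex_eq_iff power2_eq_square)

lemma Sdet_smult_one: "Sdet (x \<cdot>\<^sub>m 1\<^sub>m n) = complex_of_real (qnorm x) ^ (2 * n)"
proof -
  let ?a = "simplex_part x" and ?p = "perplex_part x"
  have "psi (x \<cdot>\<^sub>m 1\<^sub>m n) =
      four_block_mat (?a \<cdot>\<^sub>m 1\<^sub>m n) (- cnj ?p \<cdot>\<^sub>m 1\<^sub>m n) (?p \<cdot>\<^sub>m 1\<^sub>m n) (cnj ?a \<cdot>\<^sub>m 1\<^sub>m n)"
    unfolding psi_def Let_def by (intro arg_cong4[where f = four_block_mat] eq_matI) auto
  then have "Sdet (x \<cdot>\<^sub>m 1\<^sub>m n) =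
     det ((?a \<cdot>\<^sub>m 1\<^sub>m n) * (cnj ?a \<cdot>\<^sub>m 1\<^sub>m n) - (- cnj ?p \<cdot>\<^sub>m 1\<^sub>m n) * (?p \<cdot>\<^sub>m 1\<^sub>m n))"
    unfolding Sdet_def
    by (simp, subst det_four_block_mat[where n = n])
      (auto simp: mult_smult_distrib[where nr = n and n = n and nc = n]
        mult_smult_assoc_mat[where nr = n and n = n and nc = n] mult.commute)
  also have "(?a \<cdot>\<^sub>m 1\<^sub>m n) * (cnj ?a \<cdot>\<^sub>m 1\<^sub>m n) - (- cnj ?p \<cdot>\<^sub>m 1\<^sub>m n) * (?p \<cdot>\<^sub>m 1\<^sub>m n)
     = (complex_of_real (qnorm x))\<^sup>2 \<cdot>\<^sub>m 1\<^sub>m n"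
    unfolding simplex_perplex_qnorm[symmetric] by (intro eq_matI) auto
  finally show ?thesis
    by (simp add: power_mult)
qed

text \<open>
  The matrix is \<open>(c I + d J)\<^sup>2\<close>.  As \<open>S\<close> conjugates \<open>J\<close> to \<open>-J\<close>, one of the two factors may be
  replaced by \<open>c I - d J\<close> inside the determinant, and
  \<open>(c I + d J) (c I - d J) = (c\<^sup>2 - d\<^sup>2) I\<close>.
\<close>

lemma det_smult_one_add_involution:
  fixes J :: "'r :: idom mat"
  assumes J: "J \<in> carrier_mat N N" "J * J = 1\<^sub>m N"
    and S: "S \<in> carrier_mat N N" "S * S = 1\<^sub>m N" "S * J = - (J * S)"
  shows "det ((c\<^sup>2 + d\<^sup>2) \<cdot>\<^sub>m 1\<^sub>m N + (2 * c * d) \<cdot>\<^sub>m J) = (c\<^sup>2 - d\<^sup>2) ^ N"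
proof -
  let ?P = "c \<cdot>\<^sub>m 1\<^sub>m N + d \<cdot>\<^sub>m J" and ?M = "c \<cdot>\<^sub>m 1\<^sub>m N - d \<cdot>\<^sub>m J"
  note simps = add_mult_distrib_mat[where nr = N and n = N and nc = N]
     minus_mult_distrib_mat[where nr = N and n = N and nc = N]
     mult_add_distrib_mat[where nr = N and n = N and nc = N]
     mult_minus_distrib_mat[where nr = N and n = N and nc = N]
     mult_smult_distrib[where nr = N and n = N and nc = N]
     mult_smult_assoc_mat[where nr = N and n = N and nc = N]
  have P: "?P \<in> carrier_mat N N" and M: "?M \<in> carrier_mat N N" using J by auto
  have JS: "J * S \<in> carrier_mat N N" using J S by auto
  have SP: "S * ?P = ?M * S"
    using J(1) S JS by (simp add: simps) (intro eq_matI; auto)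
  have PP: "?P * ?P = (c\<^sup>2 + d\<^sup>2) \<cdot>\<^sub>m 1\<^sub>m N + (2 * c * d) \<cdot>\<^sub>m J"
    using J by (simp add: simps) (intro eq_matI; auto simp: power2_eq_square algebra_simps)
  have PM: "?P * ?M = (c\<^sup>2 - d\<^sup>2) \<cdot>\<^sub>m 1\<^sub>m N"
    using J by (simp add: simps) (intro eq_matI; auto simp: power2_eq_square algebra_simps)
  have "det S * det S = 1"
    using det_mult[OF S(1) S(1)] S(2) by simp
  moreover have "det S * det ?P = det ?M * det S"
    using det_mult[OF S(1) P] det_mult[OF M S(1)] SP by metis
  ultimately have "det ?P = det ?M"
    by (metis mult.commute mult_cancel_left mult_zero_left zero_neq_one)
  then have "det (?P * ?P) = det (?P * ?M)"
    by (simp add: det_mult[OF P P] det_mult[OF P M])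
  then show ?thesis unfolding PP PM by simp
qed


lemma sum_one_add_J_entry:
  fixes X :: "'a \<times> 'a \<Rightarrow> quat"
  assumes "finite E" "e \<in> E" "prod.swap e \<in> E"
  shows "(\<Sum>f\<in>E. ((if e = f then 1 else 0) + t * J_entry e f) * X f)
    = X e + t * X (prod.swap e)"
proof -
  have "(\<Sum>f\<in>E. ((if e = f then 1 else 0) + t * J_entry e f) * X f)
    = (\<Sum>f\<in>E. (if f = e then X f else 0) + (if f = prod.swap e then t * X f else 0))"
    by (intro sum.cong) (auto simp: J_entry_def distrib_right)
  then show ?thesis
    using assms by (simp add: sum.distrib)
qed

text \<open>
  The four blocks of \<open>psi (I + t J)\<close> are polynomials in the real matrix \<open>J\<close>, so they commute and,
  by \<open>J\<^sup>2 = I\<close>, the determinant reduces to that of \<open>(1 + |t|\<^sup>2) I + 2 (Re t) J\<close>.  An orientation of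
  the edges gives a diagonal sign matrix \<open>S\<close> that anticommutes with \<open>J\<close>, because reversing an arc
  flips its sign.  Thus \<open>det_smult_one_add_involution\<close> applies once \<open>1 + |t|\<^sup>2 = c\<^sup>2 + d\<^sup>2\<close> and
  \<open>2 Re t = 2 c d\<close> are solved in real numbers: as \<open>|1 + t|\<^sup>2\<close> and \<open>|1 - t|\<^sup>2\<close> are the sum and the
  difference of the two left-hand sides, \<open>c + d = |1 + t|\<close> and \<open>c - d = |1 - t|\<close> do it, and
  \<open>c\<^sup>2 - d\<^sup>2 = |1 - t\<^sup>2|\<close>.
\<close>

lemma Sdet_one_add_smult_reversal:
  fixes es :: "('a \<times> 'a) list"
  assumes "distinct es"
    and swap: "\<And>e. e \<in> set es \<Longrightarrow> prod.swap e \<in> set es"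
    and loopfree: "\<And>e. e \<in> set es \<Longrightarrow> fst e \<noteq> snd e"
  shows "Sdet (mat_between es es (\<lambda>e f. (if e = f then 1 else 0) + t * J_entry e f))
    = complex_of_real (qnorm (1 - t\<^sup>2)) ^ length es"
proof -
  define N where "N = length es"
  define J where "J = mat_between es es (\<lambda>e f. if f = prod.swap e then 1 else 0 :: complex)"
  \<comment> \<open>Any injective numbering of the vertices orients every edge towards its larger end.\<close>
  obtain idx :: "'a \<Rightarrow> nat" where idx: "inj_on idx (fst ` set es)"
    using finite_imp_inj_to_nat_seg[of "fst ` set es"] by auto
  define sg where "sg e = (if idx (fst e) < idx (snd e) then 1 else - 1 :: complex)"
    for e :: "'a \<times> 'a"
  define S where "S = mat_between es es (\<lambda>e f. if e = f then sg e else 0)"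
  have sg_swap: "sg (prod.swap e) = - sg e" if "e \<in> set es" for e
  proof -
    have "snd e \<in> fst ` set es"
      using swap[OF that] by force
    then have "idx (fst e) \<noteq> idx (snd e)"
      using idx loopfree[OF that] that by (metis image_eqI inj_onD)
    then show ?thesis by (auto simp: sg_def)
  qed
  then have sg_pair: "(a, b) \<in> set es \<Longrightarrow> sg (a, b) = - sg (b, a)" for a b
    by force
  have sg_sq: "sg e * sg e = 1" for e by (simp add: sg_def)
  have J: "J \<in> carrier_mat N N" and S: "S \<in> carrier_mat N N"
    by (simp_all add: J_def S_def N_def)
  have one: "1\<^sub>m N = mat_between es es (\<lambda>x y. if x = y then 1 else 0)"
    by (rule one_mat_eq_mat_between) (simp_all add: assms N_def)
  have JJ: "J * J = 1\<^sub>m N"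
    unfolding J_def mat_between_mult[OF assms(1)] one
    by (rule mat_between_cong) (auto simp: swap if_distrib[of "\<lambda>x. x * _"] cong: if_cong)
  have SS: "S * S = 1\<^sub>m N"
    unfolding S_def mat_between_mult[OF assms(1)] one
    by (rule mat_between_cong)
      (auto simp: sg_sq if_distrib[of "\<lambda>x. x * _"] cong: if_cong)
  have uminus: "- mat_between es es F = mat_between es es (\<lambda>x y. - F x y)"
    for F :: "'a \<times> 'a \<Rightarrow> 'a \<times> 'a \<Rightarrow> complex"
    by (rule eq_matI) auto
  have SJ: "S * J = - (J * S)"
    unfolding S_def J_def mat_between_mult[OF assms(1)] uminus
    by (rule mat_between_cong)
      (auto simp: swap if_distrib[of "\<lambda>x. x * _"] intro: sg_pair cong: if_cong)
  define c d where "c = complex_of_real ((qnorm (1 + t) + qnorm (1 - t)) / 2)"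
    and "d = complex_of_real ((qnorm (1 + t) - qnorm (1 - t)) / 2)"
  note simps = add_mult_distrib_mat[where nr = N and n = N and nc = N]
    mult_add_distrib_mat[where nr = N and n = N and nc = N]
    mult_smult_distrib[where nr = N and n = N and nc = N]
    mult_smult_assoc_mat[where nr = N and n = N and nc = N]
  let ?a = "simplex_part t" and ?p = "perplex_part t"
  let ?A = "1\<^sub>m N + ?a \<cdot>\<^sub>m J" and ?B = "(- cnj ?p) \<cdot>\<^sub>m J" and ?C = "?p \<cdot>\<^sub>m J"
    and ?D = "1\<^sub>m N + cnj ?a \<cdot>\<^sub>m J"
  have "psi (mat_between es es (\<lambda>e f. (if e = f then 1 else 0) + t * J_entry e f))
    = four_block_mat ?A ?B ?C ?D"
    unfolding psi_def Let_def one J_def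
    by (intro arg_cong4[where f = four_block_mat] eq_matI) (auto simp: J_entry_def)
  then have "Sdet (mat_between es es (\<lambda>e f. (if e = f then 1 else 0) + t * J_entry e f))
    = det (four_block_mat ?A ?B ?C ?D)"
    by (simp add: Sdet_def)
  also have "det (four_block_mat ?A ?B ?C ?D) = det (?A * ?D - ?B * ?C)"
  proof (rule det_four_block_mat[where n = N])
    show "?C * ?D = ?D * ?C"
      using J JJ by (simp add: simps) (intro eq_matI; auto simp: algebra_simps)
  qed (use J in auto)
  also have "?A * ?D - ?B * ?C
    = (1 + (?a * cnj ?a + cnj ?p * ?p)) \<cdot>\<^sub>m 1\<^sub>m N + (?a + cnj ?a) \<cdot>\<^sub>m J"
    using J JJ by (simp add: simps) (intro eq_matI; auto simp: algebra_simps)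
  also have "1 + (?a * cnj ?a + cnj ?p * ?p) = c\<^sup>2 + d\<^sup>2"
  proof -
    have "c\<^sup>2 + d\<^sup>2 = complex_of_real (((qnorm (1 + t))\<^sup>2 + (qnorm (1 - t))\<^sup>2) / 2)"
      by (simp add: c_def d_def power2_eq_square field_simps)
    also have "((qnorm (1 + t))\<^sup>2 + (qnorm (1 - t))\<^sup>2) / 2 = 1 + (qnorm t)\<^sup>2"
      unfolding qnorm_power2 by (simp add: quat_ops power2_eq_square field_simps)
    finally show ?thesis
      unfolding simplex_perplex_qnorm by simp
  qed
  also have "?a + cnj ?a = 2 * c * d"
  proof -
    have "2 * c * d = complex_of_real (((qnorm (1 + t))\<^sup>2 - (qnorm (1 - t))\<^sup>2) / 2)"
      by (simp add: c_def d_def power2_eq_square field_simps)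
    also have "((qnorm (1 + t))\<^sup>2 - (qnorm (1 - t))\<^sup>2) / 2 = 2 * qRe t"
      unfolding qnorm_power2 by (simp add: quat_ops power2_eq_square field_simps)
    finally show ?thesis
      by (simp add: simplex_part_def complex_eq_iff)
  qed
  also have "det ((c\<^sup>2 + d\<^sup>2) \<cdot>\<^sub>m 1\<^sub>m N + (2 * c * d) \<cdot>\<^sub>m J) = (c\<^sup>2 - d\<^sup>2) ^ N"
    by (rule det_smult_one_add_involution[OF J JJ S SS SJ])
  also have "c\<^sup>2 - d\<^sup>2 = complex_of_real (qnorm (1 + t) * qnorm (1 - t))"
    by (simp add: c_def d_def power2_eq_square field_simps)
  also have "qnorm (1 + t) * qnorm (1 - t) = qnorm (1 - t\<^sup>2)"
    unfolding qnorm_mult[symmetric] by (simp add: power2_eq_square algebra_simps)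
  finally show ?thesis by (simp add: N_def)
qed

section \<open>The theorem up to a power of the norm of \<open>1 - t\<^sup>2\<close>\<close>

text \<open>
  The weighted degrees \<open>D\<close> arise from \<open>L J K\<close>: an arc out of \<open>u\<close> whose reversal ends in \<open>v\<close> exists
  only for \<open>u = v\<close>.  The weight matrix \<open>W\<close> arises from \<open>L K\<close>, where for the labels \<open>u, v\<close> only the
  arc \<open>(u, v)\<close> contributes; that \<open>W\<close> vanishes off the arcs covers the case where it is missing.
  Since \<open>t\<close> enters through \<open>K\<close> and \<open>X\<close>, it is to the left of the weights in \<open>K L\<close>, the matrix of arcs,
  and to the right of them in \<open>L X\<close>, the matrix of vertices.
\<close>

lemma Sdet_bass_identity:
  fixes G :: "'a pair_pre_digraph" and t :: quat
  assumes "pair_graph G" and "quat_weighted_matrix G W"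
    and vs: "distinct vs" "set vs = pverts G" and es: "distinct es" "set es = parcs G"
  shows "Sdet (mat_between es es
        (\<lambda>e f. (if e = f then 1 else 0) - t * (B_entry W e f - J_entry e f)))
      * complex_of_real (qnorm (1 - t\<^sup>2)) ^ (2 * length vs)
    = complex_of_real (qnorm (1 - t\<^sup>2)) ^ length es
      * Sdet (mat_between vs vs (\<lambda>u v. (if u = v then 1 else 0) - W u v * t
          + (D_entry G W u v - (if u = v then 1 else 0)) * t\<^sup>2))"
proof -
  interpret pair_graph G by fact
  define A where "A = mat_between es es (\<lambda>e f. (if e = f then 1 else 0) + t * J_entry e f)"
  define K where "K = mat_between es vs (\<lambda>e v. if snd e = v then t else 0)"
  define L where "L = mat_between vs es (\<lambda>u f. if fst f = u then arc_weight W f else 0)"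
  \<comment> \<open>\<open>X = (I - t J) K\<close>: the product with \<open>J\<close> exchanges end and start of the arc.\<close>
  define X where "X = mat_between es vs
    (\<lambda>e v. (if snd e = v then t else 0) - (if fst e = v then t\<^sup>2 else 0))"
  define Y where "Y = mat_between vs vs (\<lambda>u v. if u = v then 1 - t\<^sup>2 else 0)"
  have fin: "finite (pverts G)" "finite (parcs G)" by auto
  have swap: "prod.swap e \<in> parcs G" if "e \<in> parcs G" for e
    using that arcs_symmetric by (cases e) auto
  have Y_eq: "Y = (1 - t\<^sup>2) \<cdot>\<^sub>m 1\<^sub>m (length vs)"
    unfolding Y_def by (rule eq_matI) (auto simp: vs nth_eq_iff_index_eq)
  have AX: "A * X = K * Y"
    unfolding A_def X_def K_def Y_def mat_between_mult[OF es(1)] mat_between_mult[OF vs(1)] es vs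
  proof (rule mat_between_cong)
    fix e v assume "e \<in> set es" "v \<in> set vs"
    then have e: "e \<in> parcs G" and v: "v \<in> pverts G" by (simp_all add: es vs)
    have "(\<Sum>y\<in>pverts G. (if snd e = y then t else 0) * (if y = v then 1 - t\<^sup>2 else 0))
      = (if snd e = v then t * (1 - t\<^sup>2) else 0)"
      using v fin by (simp add: if_distrib[of "\<lambda>x. _ * x"] cong: if_cong)
    then show "(\<Sum>f\<in>parcs G. ((if e = f then 1 else 0) + t * J_entry e f)
          * ((if snd f = v then t else 0) - (if fst f = v then t\<^sup>2 else 0)))
        = (\<Sum>y\<in>pverts G. (if snd e = y then t else 0) * (if y = v then 1 - t\<^sup>2 else 0))"
      unfolding sum_one_add_J_entry[OF fin(2) e swap[OF e]]
      by (auto simp: algebra_simps power2_eq_square)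
  qed
  have KL: "A - K * L = mat_between es es
        (\<lambda>e f. (if e = f then 1 else 0) - t * (B_entry W e f - J_entry e f))"
    (is "_ = mat_between es es ?F")
  proof -
    have "K * L = mat_between es es (\<lambda>e f. t * B_entry W e f)"
      unfolding K_def L_def mat_between_mult[OF vs(1)] vs
    proof (rule mat_between_cong)
      fix e f assume "e \<in> set es" "f \<in> set es"
      then have "snd e \<in> pverts G"
        by (simp add: es arc_snd_in_verts)
      moreover have "(\<Sum>v\<in>pverts G. (if snd e = v then t else 0) * (if fst f = v then arc_weight W f else 0))
        = (\<Sum>v\<in>pverts G. if v = snd e then t * B_entry W e f else 0)"
        by (intro sum.cong) (auto simp: B_entry_def)
      ultimately show "(\<Sum>v\<in>pverts G. (if snd e = v then t else 0) * (if fst f = v then arc_weight W f else 0))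
        = t * B_entry W e f"
        using fin by simp
    qed
    then show ?thesis
      unfolding A_def by (intro eq_matI) (auto simp: algebra_simps)
  qed
  have LX: "Y - L * X = mat_between vs vs (\<lambda>u v. (if u = v then 1 else 0) - W u v * t
          + (D_entry G W u v - (if u = v then 1 else 0)) * t\<^sup>2)"
  proof -
    have "L * X = mat_between vs vs (\<lambda>u v. W u v * t - D_entry G W u v * t\<^sup>2)"
      unfolding L_def X_def mat_between_mult[OF es(1)] es
    proof (rule mat_between_cong)
      fix u v assume "u \<in> set vs" "v \<in> set vs"
      then have uv: "u \<in> pverts G" "v \<in> pverts G" by (simp_all add: vs)
      have "(\<Sum>e\<in>parcs G. (if fst e = u then arc_weight W e else 0)
          * ((if snd e = v then t else 0) - (if fst e = v then t\<^sup>2 else 0)))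
        = (\<Sum>e\<in>parcs G. (if e = (u, v) then W u v * t else 0)
          - (if fst e = u then arc_weight W e * (if u = v then t\<^sup>2 else 0) else 0))"
        by (intro sum.cong) (auto simp: arc_weight_def algebra_simps)
      also have "\<dots> = (if (u, v) \<in> parcs G then W u v * t else 0)
          - (\<Sum>e\<in>{e \<in> parcs G. fst e = u}. arc_weight W e * (if u = v then t\<^sup>2 else 0))"
        using fin by (simp add: sum_subtractf sum.inter_filter)
      also have "(if (u, v) \<in> parcs G then W u v * t else 0) = W u v * t"
        using assms(2) uv by (auto simp: quat_weighted_matrix_def)
      also have "(\<Sum>e\<in>{e \<in> parcs G. fst e = u}. arc_weight W e * (if u = v then t\<^sup>2 else 0))
        = D_entry G W u v * t\<^sup>2"
        by (simp add: D_entry_def sum_distrib_right)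
      finally show "(\<Sum>e\<in>parcs G. (if fst e = u then arc_weight W e else 0)
          * ((if snd e = v then t else 0) - (if fst e = v then t\<^sup>2 else 0)))
        = W u v * t - D_entry G W u v * t\<^sup>2" .
    qed
    then show ?thesis
      unfolding Y_def by (intro eq_matI) (auto simp: algebra_simps)
  qed
  have "Sdet (A - K * L) * Sdet Y = Sdet A * Sdet (Y - L * X)"
    by (rule Sdet_schur_intertwining[where N = "length es" and n = "length vs"])
      (simp_all add: A_def K_def L_def X_def Y_def AX[unfolded A_def K_def X_def Y_def])
  moreover have "Sdet A = complex_of_real (qnorm (1 - t\<^sup>2)) ^ length es"
    unfolding A_def by (rule Sdet_one_add_smult_reversal) (auto simp: es swap pair_no_loops)
  ultimately show ?thesis
    unfolding KL LX unfolding Y_eq Sdet_smult_one by simp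
qed

section \<open>Continuity along the real axis\<close>

lemma continuous_det:
  fixes M :: "real \<Rightarrow> complex mat"
  assumes "\<And>y. M y \<in> carrier_mat n n"
    and "\<And>i j. i < n \<Longrightarrow> j < n \<Longrightarrow> isCont (\<lambda>y. M y $$ (i, j)) x"
  shows "isCont (\<lambda>y. det (M y)) x"
  unfolding det_def'[OF assms(1)]
  by (intro continuous_intros assms(2)) (auto simp: permutes_def)

lemma continuous_Sdet_mat_between:
  fixes F :: "real \<Rightarrow> 'b \<Rightarrow> 'b \<Rightarrow> quat"
  assumes "\<And>a b. isCont (\<lambda>y. simplex_part (F y a b)) x"
    and "\<And>a b. isCont (\<lambda>y. perplex_part (F y a b)) x"
  shows "isCont (\<lambda>y. Sdet (mat_between xs xs (F y))) x"
  unfolding Sdet_def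
proof (rule continuous_det)
  fix i j assume "i < length xs + length xs" "j < length xs + length xs"
  then have "psi (mat_between xs xs (F y)) $$ (i, j) =
      (if i < length xs
       then if j < length xs then simplex_part (F y (xs ! i) (xs ! j))
         else - cnj (perplex_part (F y (xs ! i) (xs ! (j - length xs))))
       else if j < length xs then perplex_part (F y (xs ! (i - length xs)) (xs ! j))
         else cnj (simplex_part (F y (xs ! (i - length xs)) (xs ! (j - length xs)))))" for y
    by (simp add: psi_def Let_def)
  then show "isCont (\<lambda>y. psi (mat_between xs xs (F y)) $$ (i, j)) x"
    by (cases "i < length xs"; cases "j < length xs")
      (simp_all add: assms isCont_cnj continuous_minus)
qed simp

lemma eq_at_of_eq_near:
  fixes f g :: "real \<Rightarrow> complex"
  assumes "isCont f x" "isCont g x" "\<forall>\<^sub>F y in at x. f y = g y"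
  shows "f x = g x"
proof (rule tendsto_unique[of "at x"])
  show "(f \<longlongrightarrow> f x) (at x)" using assms(1) by (simp add: isCont_def)
  show "(f \<longlongrightarrow> g x) (at x)"
    using assms(2) tendsto_cong[OF assms(3)] by (simp add: isCont_def)
qed simp

lemma of_real_quat_parts [simp]:
  "simplex_part (Quat y 0 0 0) = complex_of_real y" "perplex_part (Quat y 0 0 0) = 0"
  by (simp_all add: simplex_part_def perplex_part_def complex_eq_iff)

section \<open>The second weighted zeta function\<close>

theorem theorem4p1:
  fixes G :: "'a pair_pre_digraph"
    and W :: "'a \<Rightarrow> 'a \<Rightarrow> quat"
    and t :: quat
    and vs :: "'a list"
    and es :: "('a \<times> 'a) list"
    and n m :: nat
  assumes "pair_graph G"
    and "Digraph_Component.connected (with_proj G)"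
    and "n = card (pverts G)"
    and "m = card (edges G)"
    and "quat_weighted_matrix G W"
    and "distinct vs" and "set vs = pverts G"
    and "distinct es" and "set es = parcs G"
    and "m < n \<Longrightarrow> t^2 \<noteq> 1"
  shows "inverse (second_weighted_zeta G es W t) =
    complex_of_real (qnorm (1 - t^2) powi (2 * int m - 2 * int n)) *
    Sdet (1\<^sub>m n - mat_on vs W \<cdot>\<^sub>r t + (mat_on vs (D_entry G W) - 1\<^sub>m n) \<cdot>\<^sub>r t^2)"
proof -
  interpret pair_graph G by fact
  have n: "n = length vs"
    using assms(3,6,7) distinct_card by fastforce
  have m: "2 * m = length es"
    using card_parcs assms(4,8,9) distinct_card by fastforce
  let ?L = "\<lambda>t. Sdet (mat_between es es
        (\<lambda>e f. (if e = f then 1 else 0) - t * (B_entry W e f - J_entry e f)))"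
  let ?R = "\<lambda>t. Sdet (mat_between vs vs (\<lambda>u v. (if u = v then 1 else 0) - W u v * t
          + (D_entry G W u v - (if u = v then 1 else 0)) * t\<^sup>2))"
  let ?q = "\<lambda>t. complex_of_real (qnorm (1 - t\<^sup>2))"
  have lhs: "inverse (second_weighted_zeta G es W t) = ?L t"
  proof -
    have "1\<^sub>m (2 * card (edges G)) - t \<cdot>\<^sub>m (mat_on es (B_entry W) - mat_on es J_entry)
      = mat_between es es (\<lambda>e f. (if e = f then 1 else 0) - t * (B_entry W e f - J_entry e f))"
      using assms(8) m assms(4)
      by (intro eq_matI) (auto simp: mat_on_eq_mat_between nth_eq_iff_index_eq)
    then show ?thesis by (simp add: second_weighted_zeta_def)
  qed
  have rhs: "Sdet (1\<^sub>m n - mat_on vs W \<cdot>\<^sub>r t + (mat_on vs (D_entry G W) - 1\<^sub>m n) \<cdot>\<^sub>r t^2) = ?R t"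
    using assms(6) by (intro arg_cong[where f = Sdet] eq_matI)
      (auto simp: smult_mat_right_def mat_on_eq_mat_between nth_eq_iff_index_eq n)
  have bass: "?L s * ?q s ^ (2 * n) = ?q s ^ (2 * m) * ?R s" for s
    using Sdet_bass_identity[OF assms(1,5-9), of s] by (simp add: m n)
  have "?L t = complex_of_real (qnorm (1 - t^2) powi (2 * int m - 2 * int n)) * ?R t"
  proof (cases "t\<^sup>2 = 1")
    case False
    then have "?q t \<noteq> 0" by (simp add: qnorm_eq_0_iff)
    then have "?L t = ?q t ^ (2 * m) / ?q t ^ (2 * n) * ?R t"
      using bass[of t] by (simp add: eq_divide_eq)
    also have "?q t ^ (2 * m) / ?q t ^ (2 * n) = ?q t powi (int (2 * m) - int (2 * n))"
      using \<open>?q t \<noteq> 0\<close> unfolding power_int_of_nat[symmetric] by (rule power_int_diff[OF disjI1, symmetric])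
    finally show ?thesis
      by (simp add: of_real_power_int)
  next
    case True
    then have mn: "n \<le> m" using assms(10) by force
    \<comment> \<open>If \<open>m = n\<close>, then \<open>k = 0\<close> and the power of the norm \<open>0\<close> is \<open>0\<^sup>0 = 1\<close>.\<close>
    define k where "k = 2 * (m - n)"
    have k: "2 * int m - 2 * int n = int k" using mn by (simp add: k_def)
    have "t = 1 \<or> t = - 1" using True by (simp only: power2_eq_1_iff)
    then obtain x where t: "t = Quat x 0 0 0"
      by (auto simp: one_quat_def uminus_quat_def)
    have q: "?q (Quat y 0 0 0) = complex_of_real \<bar>1 - y\<^sup>2\<bar>" for y
    proof -
      have "(qnorm (1 - (Quat y 0 0 0)\<^sup>2))\<^sup>2 = \<bar>1 - y\<^sup>2\<bar>\<^sup>2"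
        unfolding qnorm_power2 by (simp add: quat_ops power2_eq_square)
      then show ?thesis
        using power2_eq_iff_nonneg[OF qnorm_nonneg abs_ge_zero] by simp
    qed
    \<comment> \<open>The identity with the powers of the norm cancelled holds at all real points except \<open>1\<close> and \<open>-1\<close>.\<close>
    have "?L (Quat x 0 0 0) = complex_of_real \<bar>1 - x\<^sup>2\<bar> ^ k * ?R (Quat x 0 0 0)"
    proof (rule eq_at_of_eq_near[where x = x and f = "\<lambda>y. ?L (Quat y 0 0 0)"
          and g = "\<lambda>y. complex_of_real \<bar>1 - y\<^sup>2\<bar> ^ k * ?R (Quat y 0 0 0)"])
      show "isCont (\<lambda>y. ?L (Quat y 0 0 0)) x"
        by (rule continuous_Sdet_mat_between) (auto intro!: continuous_intros)
      have "isCont (\<lambda>y. ?R (Quat y 0 0 0)) x"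
        by (rule continuous_Sdet_mat_between)
          (auto simp: power2_eq_square intro!: continuous_intros)
      then show "isCont (\<lambda>y. complex_of_real \<bar>1 - y\<^sup>2\<bar> ^ k * ?R (Quat y 0 0 0)) x"
        by (intro continuous_intros)
      have "\<forall>\<^sub>F y in at x. y \<noteq> 1 \<and> y \<noteq> - 1"
        by (intro eventually_conj eventually_neq_at_within)
      then show "\<forall>\<^sub>F y in at x. ?L (Quat y 0 0 0) = complex_of_real \<bar>1 - y\<^sup>2\<bar> ^ k * ?R (Quat y 0 0 0)"
      proof eventually_elim
        case (elim y)
        then have "1 - y\<^sup>2 \<noteq> 0" by (auto simp: power2_eq_1_iff)
        moreover have "2 * m = k + 2 * n" using mn by (simp add: k_def)
        ultimately show ?case
          using bass[of "Quat y 0 0 0"] unfolding q by (simp add: power_add)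
      qed
    qed
    then show ?thesis
      unfolding k t q[symmetric] by simp
  qed
  then show ?thesis unfolding lhs rhs .
qed

end
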